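(* Let $(X,Y)$ be a random vector with nonnegative absolutely continuous components, joint density $f$, marginal distribution functions $F_X,F_Y$, and joint distribution function $F(x,y)=C(F_X(x),F_Y(y))$, where $C$ is the copula of $(X,Y)$, with copula density $c(u,v)=\frac{\partial^2}{\partial u\,\partial v}C(u,v)$, $u,v\in(0,1)$. For $p,q\in(0,1)$ let $\xi_p=F_X^{-1}(p)$ and $\xi_q=F_Y^{-1}(q)$ (generalized inverses). Then for all $p,q\in(0,1)$ (with $C(p,q)>0$) the mutual information of the bivariate past lifetimes $[(X,Y)\,|\,X\le F_X^{-1}(p),\,Y\le F_Y^{-1}(q)]$ is given by $$\tilde M_{X,Y}(\xi_p,\xi_q)=\log[C(p,q)]+\frac{1}{C(p,q)}\int_0^p{\rm d}u\int_0^q c(u,v)\,\log\frac{c(u,v)}{\int_0^q c(u,w)\,{\rm d}w\,\int_0^p c(z,v)\,{\rm d}z}\,{\rm d}v.$$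
   Context: $\log$ is the natural logarithm; integrands are $0$ where the factor in front of the logarithm is $0$. The joint density of $(X,Y)$ is $f(x,y)=f_X(x)f_Y(y)\,c(F_X(x),F_Y(y))$, with $f_X,f_Y$ the marginal densities. For $s,t\ge0$ with $F(s,t)=\mathbb P(X\le s,Y\le t)>0$, the bivariate dynamic past mutual information is $$\tilde M_{X,Y}(s,t):=\int_0^s{\rm d}x\int_0^t \tilde f_{X,Y}(x,y;s,t)\,\log\frac{\tilde f_{X,Y}(x,y;s,t)}{\tilde f_X(x;s,t)\,\tilde f_Y(y;s,t)}\,{\rm d}y,$$ where, for $0\le x\le s$, $0\le y\le t$, $$\tilde f_{X,Y}(x,y;s,t)=\frac{f(x,y)}{F(s,t)},\quad \tilde f_X(x;s,t)=\frac{1}{F(s,t)}\int_0^t f(x,y)\,{\rm d}y,\quad \tilde f_Y(y;s,t)=\frac{1}{F(s,t)}\int_0^s f(x,y)\,{\rm d}x.$$ *)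

theory Defs
  imports "HOL-Probability.Probability"
begin

definition joint_cdf :: "'a measure \<Rightarrow> ('a \<Rightarrow> real) \<Rightarrow> ('a \<Rightarrow> real) \<Rightarrow> real \<Rightarrow> real \<Rightarrow> real" where
  "joint_cdf M X Y s t = \<P>(\<omega> in M. X \<omega> \<le> s \<and> Y \<omega> \<le> t)"

definition generalized_inverse :: "(real \<Rightarrow> real) \<Rightarrow> real \<Rightarrow> real" where
  "generalized_inverse G p = Inf {x. p \<le> G x}"

text \<open>Only the values of \<open>C\<close> on the closed unit square are meaningful.\<close>

definition copula :: "(real \<Rightarrow> real \<Rightarrow> real) \<Rightarrow> bool" where
  "copula C \<longleftrightarrow>
     (\<forall>u\<in>{0..1}. C u 0 = 0 \<and> C 0 u = 0 \<and> C u 1 = u \<and> C 1 u = u) \<and>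
     (\<forall>u1\<in>{0..1}. \<forall>u2\<in>{0..1}. \<forall>v1\<in>{0..1}. \<forall>v2\<in>{0..1}. u1 \<le> u2 \<longrightarrow> v1 \<le> v2 \<longrightarrow>
        0 \<le> C u2 v2 - C u2 v1 - C u1 v2 + C u1 v1)"

definition copula_of ::
  "'a measure \<Rightarrow> ('a \<Rightarrow> real) \<Rightarrow> ('a \<Rightarrow> real) \<Rightarrow> (real \<Rightarrow> real \<Rightarrow> real) \<Rightarrow> bool" where
  "copula_of M X Y C \<longleftrightarrow> copula C \<and>
     (\<forall>x y. joint_cdf M X Y x y = C (cdf (distr M borel X) x) (cdf (distr M borel Y) y))"

text \<open>\<open>d\<close> is the value at \<open>(u, v)\<close> of the iterated derivative: first in the second
  variable (on a neighbourhood of \<open>u\<close>), then in the first.\<close>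

definition has_mixed_partial :: "(real \<Rightarrow> real \<Rightarrow> real) \<Rightarrow> real \<Rightarrow> real \<Rightarrow> real \<Rightarrow> bool" where
  "has_mixed_partial C d u v \<longleftrightarrow>
     (\<exists>D. (\<forall>\<^sub>F u' in nhds u. (C u' has_real_derivative D u') (at v)) \<and>
          (D has_real_derivative d) (at u))"

text \<open>Densities are determined only up to null sets, and the mixed derivative of an absolutely
  continuous copula may fail to exist on one, hence almost everywhere.\<close>

definition copula_density :: "(real \<Rightarrow> real \<Rightarrow> real) \<Rightarrow> (real \<Rightarrow> real \<Rightarrow> real) \<Rightarrow> bool" where
  "copula_density C c \<longleftrightarrow>
     (AE (u, v) in lborel \<Otimes>\<^sub>M lborel.
        u \<in> {0<..<1} \<longrightarrow> v \<in> {0<..<1} \<longrightarrow> has_mixed_partial C (c u v) u v)"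

text \<open>The Lebesgue integral with values in the extended reals: positive part minus negative part.
  Mutual information may be infinite, whereas the Bochner integral of a non-integrable function
  is \<open>0\<close>.\<close>

definition ext_integral :: "'a measure \<Rightarrow> ('a \<Rightarrow> ereal) \<Rightarrow> ereal" where
  "ext_integral N g =
     enn2ereal (\<integral>\<^sup>+x. e2ennreal (g x) \<partial>N) - enn2ereal (\<integral>\<^sup>+x. e2ennreal (- g x) \<partial>N)"

lemma ext_integral_eq_integral:
  fixes g :: "'a \<Rightarrow> real"
  assumes "integrable N g"
  shows "ext_integral N (\<lambda>x. ereal (g x)) = ereal (integral\<^sup>L N g)"
proof -
  have "(\<integral>\<^sup>+x. ennreal (g x) \<partial>N) < \<infinity>" "(\<integral>\<^sup>+x. ennreal (- g x) \<partial>N) < \<infinity>"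
    using assms by (auto simp: real_integrable_def less_top)
  then show ?thesis
    unfolding ext_integral_def real_lebesgue_integral_def[OF assms]
    by (cases "\<integral>\<^sup>+x. ennreal (g x) \<partial>N"; cases "\<integral>\<^sup>+x. ennreal (- g x) \<partial>N")
       (auto simp: ennreal.rep_eq)
qed

text \<open>In the following definitions \<open>f\<close> is the joint density and \<open>F\<close> the joint distribution function.\<close>

definition past_density ::
  "(real \<Rightarrow> real \<Rightarrow> real) \<Rightarrow> (real \<Rightarrow> real \<Rightarrow> real) \<Rightarrow> real \<Rightarrow> real \<Rightarrow> real \<Rightarrow> real \<Rightarrow> real" where
  "past_density f F s t x y = f x y / F s t"

definition past_density_fst ::
  "(real \<Rightarrow> real \<Rightarrow> real) \<Rightarrow> (real \<Rightarrow> real \<Rightarrow> real) \<Rightarrow> real \<Rightarrow> real \<Rightarrow> real \<Rightarrow> real" where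
  "past_density_fst f F s t x = 1 / F s t * (LINT y|lebesgue_on {0..t}. f x y)"

definition past_density_snd ::
  "(real \<Rightarrow> real \<Rightarrow> real) \<Rightarrow> (real \<Rightarrow> real \<Rightarrow> real) \<Rightarrow> real \<Rightarrow> real \<Rightarrow> real \<Rightarrow> real" where
  "past_density_snd f F s t y = 1 / F s t * (LINT x|lebesgue_on {0..s}. f x y)"

definition past_mutual_information ::
  "(real \<Rightarrow> real \<Rightarrow> real) \<Rightarrow> (real \<Rightarrow> real \<Rightarrow> real) \<Rightarrow> real \<Rightarrow> real \<Rightarrow> ereal" where
  "past_mutual_information f F s t =
     ext_integral (lebesgue_on {0..s}) (\<lambda>x. ext_integral (lebesgue_on {0..t}) (\<lambda>y.
       ereal (past_density f F s t x y *
         ln (past_density f F s t x y / (past_density_fst f F s t x * past_density_snd f F s t y)))))"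

end

theory Submission
  imports Defs
begin

text \<open>Let \<open>S\<close> and \<open>T\<close> be the quantile functions of \<open>X\<close> and \<open>Y\<close>. They push Lebesgue measure on \<open>[0, p]\<close>
  and \<open>[0, q]\<close> forward to the marginal laws restricted to \<open>[0, \<xi>\<^sub>p]\<close> and \<open>[0, \<xi>\<^sub>q]\<close>. Under
  \<open>x = S u\<close>, \<open>y = T v\<close> the marginal densities cancel inside the logarithm, because \<open>f = f\<^sub>X f\<^sub>Y h\<close> with
  \<open>h (S u) (T v) = c u v\<close> almost everywhere, and the normalisation by \<open>F(\<xi>\<^sub>p, \<xi>\<^sub>q) = C(p, q)\<close> leaves the
  factor \<open>C(p, q)\<close> inside the logarithm. Its contribution \<open>ln (C p q)\<close> is finite and can
  be split off even when the remaining extended integral is infinite, since adding an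
  integrable function changes the positive and the negative part by finite amounts only.\<close>

section \<open>Calculus of extended integrals\<close>

lemma ext_integral_cong_AE:
  assumes "AE x in N. g x = h x"
  shows "ext_integral N g = ext_integral N h"
proof -
  have "(\<integral>\<^sup>+x. e2ennreal (g x) \<partial>N) = (\<integral>\<^sup>+x. e2ennreal (h x) \<partial>N)"
    and "(\<integral>\<^sup>+x. e2ennreal (- g x) \<partial>N) = (\<integral>\<^sup>+x. e2ennreal (- h x) \<partial>N)"
    using assms by (auto intro!: nn_integral_cong_AE)
  then show ?thesis
    by (simp add: ext_integral_def)
qed

text \<open>A nonnegative integral is a supremum over simple functions below the integrand, and
  completion leaves it unchanged even for non-measurable integrands. Hence \<open>g\<close> may
  later involve \<open>c\<close>.\<close>

lemma ext_integral_lebesgue_on: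
  assumes "S \<in> sets borel"
  shows "ext_integral (lebesgue_on S) g = ext_integral (restrict_space lborel S) g"
  using assms by (simp add: ext_integral_def nn_integral_restrict_space nn_integral_completion)

lemma ext_integral_distr:
  assumes [measurable]: "T \<in> measurable N L" "g \<in> borel_measurable L"
  shows "ext_integral (distr N L T) g = ext_integral N (\<lambda>x. g (T x))"
  by (simp add: ext_integral_def nn_integral_distr)

lemma e2ennreal_mult_left: "0 \<le> r \<Longrightarrow> e2ennreal (ereal r * x) = ennreal r * e2ennreal x"
proof (cases "0 \<le> x")
  case True
  assume r: "0 \<le> r"
  show ?thesis
    using True r by (cases x) (auto simp: ennreal_mult' ennreal_mult_top ennreal_eq_0_iff)
next
  case False
  assume "0 \<le> r"
  with False have "ereal r * x \<le> 0"
    by (simp add: ereal_mult_le_0_iff)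
  then show ?thesis
    using False by (simp add: e2ennreal_neg)
qed

lemma ext_integral_density:
  assumes [measurable]: "a \<in> borel_measurable N" "g \<in> borel_measurable N" and a: "\<And>x. 0 \<le> a x"
  shows "ext_integral (density N (\<lambda>x. ennreal (a x))) g = ext_integral N (\<lambda>x. ereal (a x) * g x)"
proof -
  have "e2ennreal (- (ereal (a x) * g x)) = ennreal (a x) * e2ennreal (- g x)" for x
    using e2ennreal_mult_left[OF a, of x "- g x"] by simp
  then show ?thesis
    by (simp add: ext_integral_def nn_integral_density e2ennreal_mult_left[OF a])
qed

lemma ext_integral_cmult:
  assumes [measurable]: "g \<in> borel_measurable N" and r: "0 \<le> r"
  shows "ext_integral N (\<lambda>x. ereal r * g x) = ereal r * ext_integral N g"
proof -
  have *: "e2ennreal (- (ereal r * g x)) = ennreal r * e2ennreal (- g x)" for x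
    using e2ennreal_mult_left[OF r, of "- g x"] by simp
  have "enn2ereal (ennreal r * P) - enn2ereal (ennreal r * Q) = ereal r * (enn2ereal P - enn2ereal Q)"
    for P Q
  \<comment> \<open>For \<open>r > 0\<close> infinite parts stay infinite, in accordance with
    \<open>\<infinity> - \<infinity> = \<infinity>\<close>; for \<open>r = 0\<close> both sides are
    0 by \<open>0 * \<infinity> = 0\<close>.\<close>
  proof (cases "r = 0")
    case False
    then show ?thesis
      using r
      by (cases P; cases Q)
         (auto simp: ennreal_mult[symmetric] ennreal_mult_top ennreal_top_mult
            ennreal_eq_0_iff right_diff_distrib ennreal.rep_eq)
  qed (simp add: zero_ennreal.rep_eq)
  then show ?thesis
    by (simp add: ext_integral_def nn_integral_cmult * e2ennreal_mult_left[OF r])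
qed

text \<open>Positive and negative parts are not additive, so the parts of the sum are only bounded
  by those of \<open>g\<close> and \<open>h\<close>. The bounds show that a part of \<open>g\<close>
  is infinite iff the same part of the sum is; when all are finite, an identity without subtraction
  gives the claim.\<close>

lemma ext_integral_add_real:
  assumes [measurable]: "g \<in> borel_measurable N" and h: "integrable N h"
  shows "ext_integral N (\<lambda>x. g x + ereal (h x)) = ext_integral N g + ereal (integral\<^sup>L N h)"
proof -
  have [measurable]: "h \<in> borel_measurable N"
    using h by simp
  define P where "P = (\<integral>\<^sup>+x. e2ennreal (g x) \<partial>N)"
  define Q where "Q = (\<integral>\<^sup>+x. e2ennreal (- g x) \<partial>N)"
  define P' where "P' = (\<integral>\<^sup>+x. e2ennreal (g x + ereal (h x)) \<partial>N)"
  define Q' where "Q' = (\<integral>\<^sup>+x. e2ennreal (- (g x + ereal (h x))) \<partial>N)"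
  define A where "A = (\<integral>\<^sup>+x. ennreal (h x) \<partial>N)"
  define B where "B = (\<integral>\<^sup>+x. ennreal (- h x) \<partial>N)"
  note defs = P_def Q_def P'_def Q'_def A_def B_def
  have fin: "A < \<infinity>" "B < \<infinity>"
    using h by (auto simp: A_def B_def real_integrable_def less_top)
  \<comment> \<open>The four bounds carry finiteness between the parts of \<open>y\<close> and
    \<open>y + z\<close> in both directions. The equality is additivity with the negative parts
    moved across, so it makes sense in \<open>ennreal\<close> and holds for infinite
    \<open>y\<close> too.\<close>
  have "e2ennreal (y + ereal z) \<le> e2ennreal y + ennreal z \<and>
      e2ennreal (- (y + ereal z)) \<le> e2ennreal (- y) + ennreal (- z) \<and>
      e2ennreal y \<le> e2ennreal (y + ereal z) + ennreal (- z) \<and>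
      e2ennreal (- y) \<le> e2ennreal (- (y + ereal z)) + ennreal z \<and>
      e2ennreal (y + ereal z) + e2ennreal (- y) + ennreal (- z) =
      e2ennreal (- (y + ereal z)) + e2ennreal y + ennreal z" for y z
  proof (cases y)
    case (real b)
    have plus: "ennreal c + ennreal d = ennreal (max 0 c + max 0 d)" for c d
      by (subst ennreal_plus) (auto simp: max_def ennreal_neg)
    have le: "ennreal c \<le> ennreal d \<longleftrightarrow> c \<le> 0 \<or> c \<le> d" for c d
      by (cases "0 \<le> c") (auto simp: ennreal_le_iff2 ennreal_neg)
    show ?thesis
      unfolding real by (simp add: plus le max_def del: ennreal_plus)
  qed (auto simp: e2ennreal_neg)
  note pw = this[THEN conjunct1] this[THEN conjunct2, THEN conjunct1]
    this[THEN conjunct2, THEN conjunct2, THEN conjunct1]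
    this[THEN conjunct2, THEN conjunct2, THEN conjunct2, THEN conjunct1]
    this[THEN conjunct2, THEN conjunct2, THEN conjunct2, THEN conjunct2]
  have "P' \<le> P + A" "Q' \<le> Q + B" "P \<le> P' + B" "Q \<le> Q' + A"
    unfolding defs by (subst nn_integral_add[symmetric]; (simp; fail)?; intro nn_integral_mono pw)+
  moreover have "P' + Q + B = Q' + P + A"
  proof -
    have "P' + Q + B = (\<integral>\<^sup>+x. e2ennreal (g x + ereal (h x)) + e2ennreal (- g x) + ennreal (- h x) \<partial>N)"
      unfolding defs by (subst nn_integral_add; (simp; fail)?)+
    also have "\<dots> = Q' + P + A"
      unfolding pw(5) defs by (subst nn_integral_add; (simp; fail)?)+
    finally show ?thesis .
  qed
  ultimately have "enn2ereal P' - enn2ereal Q' = enn2ereal P - enn2ereal Q + (enn2ereal A - enn2ereal B)"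
  proof -
    assume le: "P' \<le> P + A" "Q' \<le> Q + B" "P \<le> P' + B" "Q \<le> Q' + A"
      and eq: "P' + Q + B = Q' + P + A"
    obtain \<alpha> \<beta> where AB: "0 \<le> \<alpha>" "A = ennreal \<alpha>" "0 \<le> \<beta>" "B = ennreal \<beta>"
      using fin by (cases A; cases B) auto
    consider "P = \<top>" "P' = \<top>" | p p' where "0 \<le> p" "P = ennreal p" "0 \<le> p'" "P' = ennreal p'"
      using le(1,3) AB by (cases P; cases P') (auto simp: top_unique)
    then show ?thesis
    proof cases
      \<comment> \<open>Since \<open>\<infinity> - \<infinity> = \<infinity>\<close> in
        \<open>ereal\<close>, both sides are \<open>\<infinity>\<close> whatever \<open>Q\<close>
        and \<open>Q'\<close> are.\<close>
      case 1
      then show ?thesis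
        by (simp add: AB enn2ereal_ennreal)
    next
      case P: 2
      consider "Q = \<top>" "Q' = \<top>" | q q' where "0 \<le> q" "Q = ennreal q" "0 \<le> q'" "Q' = ennreal q'"
        using le(2,4) AB by (cases Q; cases Q') (auto simp: top_unique)
      then show ?thesis
      proof cases
        case 1
        then show ?thesis
          using P AB by (simp add: enn2ereal_ennreal)
      next
        case 2
        with P AB eq have "ennreal (p' + q + \<beta>) = ennreal (q' + p + \<alpha>)"
          by simp
        then have "p' + q + \<beta> = q' + p + \<alpha>"
          using 2 P AB by (subst (asm) ennreal_inj) auto
        then show ?thesis
          using 2 P AB by (simp add: enn2ereal_ennreal)
      qed
    qed
  qed
  moreover have "enn2ereal A - enn2ereal B = ereal (integral\<^sup>L N h)"
    using ext_integral_eq_integral[OF h] by (simp add: ext_integral_def A_def B_def)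
  ultimately show ?thesis
    by (simp add: ext_integral_def defs)
qed

lemma borel_measurable_ext_integral:
  assumes "sigma_finite_measure W"
    and [measurable]: "(\<lambda>(u, v). g u v) \<in> borel_measurable (V \<Otimes>\<^sub>M W)"
  shows "(\<lambda>u. ext_integral W (g u)) \<in> borel_measurable V"
proof -
  interpret sigma_finite_measure W by fact
  show ?thesis
    unfolding ext_integral_def by measurable
qed

section \<open>Lebesgue integrals of functions known only almost everywhere\<close>

lemma (in complete_measure) borel_measurable_AE_eq:
  fixes f g :: "'a \<Rightarrow> 'b::topological_space"
  assumes g: "g \<in> borel_measurable M" and eq: "AE x in M. f x = g x"
  shows "f \<in> borel_measurable M"
proof (rule measurableI)
  fix A :: "'b set" assume "A \<in> sets borel"
  then have "g -` A \<inter> space M \<in> sets M"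
    using g by (rule measurable_sets[rotated])
  \<comment> \<open>The preimages under \<open>f\<close> and \<open>g\<close> differ by a null set,
    which completeness makes measurable.\<close>
  moreover have "AE x in M. x \<in> g -` A \<inter> space M \<longleftrightarrow> x \<in> f -` A \<inter> space M"
    using eq by eventually_elim auto
  ultimately show "f -` A \<inter> space M \<in> sets M"
    using in_sets_AE[of "g -` A \<inter> space M" "f -` A \<inter> space M"] by blast
qed simp

text \<open>The Bochner integral of a non-measurable function is 0 by default, so almost everywhere
  equality alone does not suffice. Completeness of Lebesgue measure makes \<open>f\<close>
  measurable on \<open>S\<close>, after which the Borel function \<open>g\<close> can replace
  it.\<close>

lemma integral_lebesgue_on_AE_eq:
  fixes f g :: "real \<Rightarrow> real"
  assumes S [measurable]: "S \<in> sets borel"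
    and g: "g \<in> borel_measurable (restrict_space lborel S)"
    and eq: "AE x in restrict_space lborel S. f x = g x"
  shows "integral\<^sup>L (lebesgue_on S) f = integral\<^sup>L (restrict_space lborel S) g"
proof -
  have g': "(\<lambda>x. indicator S x *\<^sub>R g x) \<in> borel_measurable lborel"
    using g by (subst (asm) borel_measurable_restrict_space_iff) auto
  then have g'': "(\<lambda>x. indicator S x *\<^sub>R g x) \<in> borel_measurable lebesgue"
    by (rule measurable_completion)
  have "AE x in lborel. indicator S x *\<^sub>R f x = indicator S x *\<^sub>R g x"
    using eq by (auto simp: AE_restrict_space_iff indicator_def)
  then have eq': "AE x in lebesgue. indicator S x *\<^sub>R f x = indicator S x *\<^sub>R g x"
    by (rule AE_completion)
  have "(\<lambda>x. indicator S x *\<^sub>R f x) \<in> borel_measurable lebesgue"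
    using g'' eq' by (rule completion.borel_measurable_AE_eq)
  then have "integral\<^sup>L lebesgue (\<lambda>x. indicator S x *\<^sub>R f x) =
      integral\<^sup>L lebesgue (\<lambda>x. indicator S x *\<^sub>R g x)"
    using g'' eq' by (rule integral_cong_AE)
  also have "\<dots> = integral\<^sup>L lborel (\<lambda>x. indicator S x *\<^sub>R g x)"
    using g' by (rule integral_completion)
  finally show ?thesis
    using S by (simp only: integral_restrict_space sets.Int space_completion sets_completionI_sets
        sets_lborel space_lborel space_borel Int_UNIV_right)
qed

section \<open>Splitting off the logarithm of the normalising constant\<close>

text \<open>Dividing \<open>k\<close>, \<open>K1\<close> and \<open>K2\<close> by \<open>r\<close>
  multiplies the density ratio by \<open>r\<close>. The logarithm splits where all three are
  positive; where \<open>k\<close> is 0 both integrands vanish; the remaining points are negligible.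
  The extra term \<open>ln r / r * k\<close> integrates to \<open>ln r\<close>.\<close>

lemma ext_integral_information_rescale:
  fixes k :: "'a \<Rightarrow> 'b \<Rightarrow> real"
  assumes "sigma_finite_measure V" "sigma_finite_measure W"
    and k_meas [measurable]: "(\<lambda>(u, v). k u v) \<in> borel_measurable (V \<Otimes>\<^sub>M W)"
    and k: "\<And>u v. 0 \<le> k u v"
    and total: "(\<integral>\<^sup>+u. \<integral>\<^sup>+v. ennreal (k u v) \<partial>W \<partial>V) = ennreal r" and r: "0 < r"
  defines "K1 \<equiv> \<lambda>u. LINT v|W. k u v" and "K2 \<equiv> \<lambda>v. LINT u|V. k u v"
  shows "ext_integral V (\<lambda>u. ext_integral W (\<lambda>v.
            ereal (k u v / r * ln (r * k u v / (K1 u * K2 v))))) =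
         ereal (ln r) + ereal (1 / r) *
           ext_integral V (\<lambda>u. ext_integral W (\<lambda>v. ereal (k u v * ln (k u v / (K1 u * K2 v)))))"
proof -
  interpret V: sigma_finite_measure V by fact
  interpret W: sigma_finite_measure W by fact
  interpret pair_sigma_finite V W ..
  have k_meas' [measurable]: "(\<lambda>(v, u). k u v) \<in> borel_measurable (W \<Otimes>\<^sub>M V)"
    by (subst measurable_split_conv, rule measurable_compose[OF _ k_meas, of "\<lambda>x. (snd x, fst x)", simplified]) simp
  have [measurable]: "K1 \<in> borel_measurable V" "K2 \<in> borel_measurable W"
    unfolding K1_def K2_def by measurable
  have kn: "(\<lambda>(u, v). ennreal (k u v)) \<in> borel_measurable (V \<Otimes>\<^sub>M W)"
    by measurable
  have fin1: "AE u in V. integrable W (k u)"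
  proof -
    have "AE u in V. (\<integral>\<^sup>+v. ennreal (k u v) \<partial>W) \<noteq> \<infinity>"
      by (intro nn_integral_noteq_infinite) (auto simp: total)
    then show ?thesis
      using AE_space
    proof eventually_elim
      case (elim u)
      note [measurable] = elim(2)
      then show ?case
        using elim k by (auto simp: integrable_iff_bounded less_top)
    qed
  qed
  have fin2: "AE v in W. integrable V (\<lambda>u. k u v)"
  proof -
    have "(\<integral>\<^sup>+v. \<integral>\<^sup>+u. ennreal (k u v) \<partial>V \<partial>W) = ennreal r"
      unfolding total[symmetric] by (rule Fubini'[OF kn])
    then have "AE v in W. (\<integral>\<^sup>+u. ennreal (k u v) \<partial>V) \<noteq> \<infinity>"
      by (intro nn_integral_noteq_infinite) auto
    then show ?thesis
      using AE_space
    proof eventually_elim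
      case (elim v)
      note [measurable] = elim(2)
      then show ?case
        using elim k by (auto simp: integrable_iff_bounded less_top)
    qed
  qed
  \<comment> \<open>\<open>K1\<close> is a Bochner integral and would be 0 on non-integrable
    sections; \<open>fin1\<close> confines these to a null set.\<close>
  have nn: "(\<integral>\<^sup>+u. ennreal (K1 u) \<partial>V) = ennreal r"
    unfolding total[symmetric] using fin1
  proof (intro nn_integral_cong_AE, eventually_elim)
    case (elim u)
    then show ?case
      using k by (simp add: K1_def nn_integral_eq_integral)
  qed
  \<comment> \<open>A vanishing marginal forces its section of \<open>k\<close> to vanish almost
    everywhere.\<close>
  have pos1: "AE u in V. AE v in W. k u v > 0 \<longrightarrow> K1 u > 0"
    using fin1
  proof eventually_elim
    case (elim u)
    show ?case
    proof (cases "K1 u = 0")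
      case True
      then have "AE v in W. k u v = 0"
        using elim k by (simp add: K1_def integral_nonneg_eq_0_iff_AE)
      then show ?thesis
        by eventually_elim simp
    next
      case False
      then show ?thesis
        using k by (simp add: K1_def less_le Bochner_Integration.integral_nonneg)
    qed
  qed
  have "AE v in W. AE u in V. k u v > 0 \<longrightarrow> K2 v > 0"
    using fin2
  proof eventually_elim
    case (elim v)
    show ?case
    proof (cases "K2 v = 0")
      case True
      then have "AE u in V. k u v = 0"
        using elim k by (simp add: K2_def integral_nonneg_eq_0_iff_AE)
      then show ?thesis
        by eventually_elim simp
    next
      case False
      then show ?thesis
        using k by (simp add: K2_def less_le Bochner_Integration.integral_nonneg)
    qed
  qed
  then have pos2: "AE u in V. AE v in W. k u v > 0 \<longrightarrow> K2 v > 0"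
    by (subst AE_commute) auto
  define G where "G u = ext_integral W (\<lambda>v. ereal (k u v * ln (k u v / (K1 u * K2 v))))" for u
  have [measurable]: "G \<in> borel_measurable V"
    unfolding G_def by (intro borel_measurable_ext_integral) (unfold_locales, measurable)
  have "AE u in V. ext_integral W (\<lambda>v. ereal (k u v / r * ln (r * k u v / (K1 u * K2 v)))) =
      ereal (1 / r) * G u + ereal (ln r / r * K1 u)"
    using fin1 pos1 pos2 AE_space
  proof eventually_elim
    case (elim u)
    note [measurable] = elim(4)
    have "AE v in W. ereal (k u v / r * ln (r * k u v / (K1 u * K2 v))) =
        ereal (1 / r) * ereal (k u v * ln (k u v / (K1 u * K2 v))) + ereal (ln r / r * k u v)"
      using elim(2,3)
    proof eventually_elim
      case (elim v)
      show ?case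
      proof (cases "k u v = 0")
        case False
        then have pos: "0 < k u v" "0 < K1 u" "0 < K2 v"
          using k[of u v] elim by auto
        then have "ln (r * k u v / (K1 u * K2 v)) = ln r + ln (k u v / (K1 u * K2 v))"
          using r ln_mult_pos[of r "k u v / (K1 u * K2 v)"] by simp
        then show ?thesis
          using r by (simp add: field_simps)
      qed simp
    qed
    then have "ext_integral W (\<lambda>v. ereal (k u v / r * ln (r * k u v / (K1 u * K2 v)))) =
      ext_integral W (\<lambda>v. ereal (1 / r) * ereal (k u v * ln (k u v / (K1 u * K2 v))) +
        ereal (ln r / r * k u v))"
      by (rule ext_integral_cong_AE)
    also have "\<dots> = ext_integral W (\<lambda>v. ereal (1 / r) * ereal (k u v * ln (k u v / (K1 u * K2 v)))) +
        ereal (LINT v|W. ln r / r * k u v)"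
      using elim(1) by (intro ext_integral_add_real) auto
    also have "\<dots> = ereal (1 / r) * G u + ereal (ln r / r * K1 u)"
      unfolding G_def K1_def using r by (subst ext_integral_cmult) auto
    finally show ?case .
  qed
  then have "ext_integral V (\<lambda>u. ext_integral W (\<lambda>v.
            ereal (k u v / r * ln (r * k u v / (K1 u * K2 v))))) =
      ext_integral V (\<lambda>u. ereal (1 / r) * G u + ereal (ln r / r * K1 u))"
    by (rule ext_integral_cong_AE)
  also have "\<dots> = ereal (1 / r) * ext_integral V G + ereal (LINT u|V. ln r / r * K1 u)"
  proof -
    have int: "integrable V K1"
      using k nn by (intro integrableI_nonneg) (auto simp: K1_def intro!: Bochner_Integration.integral_nonneg)
    show ?thesis
      using int r by (subst ext_integral_add_real) (auto simp: ext_integral_cmult)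
  qed
  also have "(LINT u|V. ln r / r * K1 u) = ln r"
  proof -
    have "integral\<^sup>L V K1 = r"
      using k nn r
      by (subst integral_eq_nn_integral) (auto simp: K1_def intro!: Bochner_Integration.integral_nonneg)
    then show ?thesis
      using r by simp
  qed
  finally show ?thesis
    unfolding G_def by (simp add: add.commute)
qed

section \<open>Change of variables along a push-forward\<close>

text \<open>The factor \<open>a\<close> of the integrand is the density of the push-forward under
  \<open>T\<close>, so it is absorbed into the measure and \<open>g\<close> is pulled back to
  \<open>V\<close>. This serves both the outer and the inner extended integral.\<close>

lemma ext_integral_lebesgue_on_transport:
  assumes [measurable]: "S \<in> sets borel" "a \<in> borel_measurable borel" "g \<in> borel_measurable borel"
      "T \<in> borel_measurable V"
    and a: "\<And>x. 0 \<le> a x" "\<And>x. x \<notin> S \<Longrightarrow> a x = 0"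
    and T: "distr V borel T = density lborel (\<lambda>x. ennreal (a x))"
    and eq: "AE x in lborel. x \<in> S \<longrightarrow> G x = ereal (a x) * g x"
  shows "ext_integral (lebesgue_on S) G = ext_integral V (\<lambda>u. g (T u))"
proof -
  have "ext_integral (lebesgue_on S) G = ext_integral (restrict_space lborel S) (\<lambda>x. ereal (a x) * g x)"
    using eq by (auto simp: ext_integral_lebesgue_on AE_restrict_space_iff intro!: ext_integral_cong_AE)
  also have "\<dots> = ext_integral lborel (\<lambda>x. ereal (a x) * g x)"
  proof -
    have "e2ennreal (ereal (a x) * g x) * indicator S x = e2ennreal (ereal (a x) * g x)"
      and "e2ennreal (- (ereal (a x) * g x)) * indicator S x = e2ennreal (- (ereal (a x) * g x))" for x
      using a(2)[of x] by (auto simp: indicator_def zero_ereal_def[symmetric])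
    then show ?thesis
      by (simp add: ext_integral_def nn_integral_restrict_space)
  qed
  also have "\<dots> = ext_integral (distr V borel T) g"
    unfolding T using a(1) by (simp add: ext_integral_density)
  also have "\<dots> = ext_integral V (\<lambda>u. g (T u))"
    by (simp add: ext_integral_distr)
  finally show ?thesis .
qed

text \<open>The analogue for the truncated marginals, which are Bochner integrals; \<open>G\<close>
  inherits measurability on \<open>S\<close> from \<open>a * g\<close>.\<close>

lemma integral_lebesgue_on_transport:
  fixes a g G :: "real \<Rightarrow> real"
  assumes [measurable]: "S \<in> sets borel" "a \<in> borel_measurable borel" "g \<in> borel_measurable borel"
      "T \<in> borel_measurable V"
    and a: "\<And>x. 0 \<le> a x" "\<And>x. x \<notin> S \<Longrightarrow> a x = 0"
    and T: "distr V borel T = density lborel (\<lambda>x. ennreal (a x))"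
    and eq: "AE x in lborel. x \<in> S \<longrightarrow> G x = a x * g x"
  shows "integral\<^sup>L (lebesgue_on S) G = (LINT u|V. g (T u))"
proof -
  have "integral\<^sup>L (lebesgue_on S) G = integral\<^sup>L (restrict_space lborel S) (\<lambda>x. a x * g x)"
    using eq by (intro integral_lebesgue_on_AE_eq) (auto simp: AE_restrict_space_iff intro!: measurable_restrict_space1)
  also have "\<dots> = (LINT x|lborel. indicator S x *\<^sub>R (a x * g x))"
    by (intro integral_restrict_space) auto
  also have "\<dots> = (LINT x|lborel. a x *\<^sub>R g x)"
    using a(2) by (intro Bochner_Integration.integral_cong) (auto simp: indicator_def)
  also have "\<dots> = integral\<^sup>L (distr V borel T) g"
    unfolding T using a(1) by (intro integral_density[symmetric]) auto
  also have "\<dots> = (LINT u|V. g (T u))"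
    by (simp add: integral_distr)
  finally show ?thesis .
qed

section \<open>Quantile functions of continuous laws\<close>

text \<open>The Galois connection with the distribution function gives
  \<open>p \<le> cdf D ?I\<close>. A strict inequality would persist slightly to the left of
  \<open>?I\<close> by continuity, against the minimality of \<open>?I\<close>.\<close>

lemma cdf_generalized_inverse:
  assumes "real_distribution D" and cdf_cont: "continuous_on UNIV (cdf D)" and p: "0 < p" "p < 1"
  shows "cdf D (generalized_inverse (cdf D) p) = p"
proof -
  interpret cdf_distribution D
    unfolding cdf_distribution_def by fact
  let ?I = "generalized_inverse (cdf D) p"
  have inv: "p \<le> cdf D x \<longleftrightarrow> ?I \<le> x" for x
    unfolding generalized_inverse_def by (rule pseudoinverse[OF p])
  have "\<not> p < cdf D ?I"
  proof
    assume "p < cdf D ?I"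
    moreover have "(cdf D \<longlongrightarrow> cdf D ?I) (at_left ?I)"
      by (rule tendsto_within_subset[OF bspec[OF cdf_cont[unfolded continuous_on_def] UNIV_I] subset_UNIV])
    ultimately have "\<forall>\<^sub>F x in at_left ?I. p < cdf D x"
      by (rule order_tendstoD(1)[rotated])
    moreover have "\<forall>\<^sub>F x in at_left ?I. x < ?I"
      by (simp add: eventually_at_filter)
    ultimately have "\<forall>\<^sub>F x in at_left ?I. False"
      by eventually_elim (use inv in \<open>meson less_imp_le not_le\<close>)
    then show False
      by simp
  qed
  then show ?thesis
    using inv[of ?I] by simp
qed

lemma density_lborel_continuous_cdf:
  assumes "real_distribution (density lborel g)" and [measurable]: "g \<in> borel_measurable borel"
  shows "continuous_on UNIV (cdf (density lborel g))"
proof -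
  interpret real_distribution "density lborel g" by fact
  have "emeasure (density lborel g) {x} = 0" for x
    by (subst emeasure_density) (auto simp: nn_integral_0_iff_AE indicator_def intro: AE_mp[OF AE_lborel_singleton])
  then show ?thesis
    by (auto simp: continuous_on_eq_continuous_within isCont_cdf measure_def)
qed

text \<open>Measurability is known on the open unit interval. At 0 the infimum is over the whole
  line and its value carries no meaning, but a single point does not affect measurability.\<close>

lemma borel_measurable_generalized_inverse:
  assumes "real_distribution D" and p: "0 \<le> p" "p < 1"
  shows "generalized_inverse (cdf D) \<in> borel_measurable (restrict_space lborel {0..p})"
proof -
  interpret cdf_distribution D
    unfolding cdf_distribution_def by fact
  have "(\<lambda>u. indicator {0<..<1} u *\<^sub>R generalized_inverse (cdf D) u) \<in> borel_measurable borel"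
    using measurable_CI
    by (subst borel_measurable_restrict_space_iff[symmetric])
       (auto simp: generalized_inverse_def[abs_def])
  then have "(\<lambda>u. indicator {0<..<1} u *\<^sub>R generalized_inverse (cdf D) u)
      \<in> borel_measurable (restrict_space lborel {0..p})"
    by (intro measurable_restrict_space1) simp
  then show ?thesis
    by (rule measurable_discrete_difference[where X="{0}"])
       (use p in \<open>auto simp: space_restrict_space sets_restrict_space_iff\<close>)
qed

text \<open>The quantile transform pushes the uniform law forward to the given law; cutting both at the
  quantile of order \<open>p\<close> keeps them matched.\<close>

lemma distr_generalized_inverse:
  fixes g :: "real \<Rightarrow> real"
  assumes D: "real_distribution (density lborel g)" (is "real_distribution ?D")
    and [measurable]: "g \<in> borel_measurable borel"
    and supp: "AE x in lborel. x < 0 \<longrightarrow> g x = 0"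
    and p: "0 < p" "p < 1"
  defines "T \<equiv> generalized_inverse (cdf (density lborel g))"
  shows "distr (restrict_space lborel {0..p}) borel T =
    density lborel (\<lambda>x. ennreal (g x * indicator {0..T p} x))"
proof (rule measure_eqI)
  interpret cdf_distribution ?D
    unfolding cdf_distribution_def by fact
  let ?V = "restrict_space lborel {0..p}" and ?U = "restrict_space lborel {0<..<1::real}"
  have T_eq: "T = (\<lambda>u. Inf {x. u \<le> cdf ?D x})"
    by (simp add: T_def generalized_inverse_def[abs_def])
  have TU: "T \<in> borel_measurable ?U"
    unfolding T_eq using measurable_CI by (simp cong: measurable_cong_sets sets_restrict_space_cong)
  have TV: "T \<in> borel_measurable ?V"
    unfolding T_def using D p by (auto intro!: borel_measurable_generalized_inverse)
  have T_le: "T u \<le> T p \<longleftrightarrow> u \<le> p" if "0 < u" "u < 1" for u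
  proof -
    have "u \<le> cdf ?D (T p) \<longleftrightarrow> T u \<le> T p"
      unfolding T_eq by (rule pseudoinverse[OF that])
    moreover have "cdf ?D (T p) = p"
      unfolding T_def using D p by (intro cdf_generalized_inverse density_lborel_continuous_cdf) auto
    ultimately show ?thesis
      by simp
  qed
  fix A :: "real set" assume "A \<in> sets (distr ?V borel T)"
  then have A [measurable]: "A \<in> sets borel"
    by simp
  have "emeasure (distr ?V borel T) A = (\<integral>\<^sup>+u. indicator A (T u) \<partial>?V)"
    using A TV by (simp add: nn_integral_distr[symmetric])
  also have "\<dots> = (\<integral>\<^sup>+u. indicator A (T u) * indicator {0..p} u \<partial>lborel)"
    by (simp add: nn_integral_restrict_space)
  \<comment> \<open>Off the point 0, cutting at \<open>p\<close> is cutting at \<open>T p\<close>.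
    This passes to the full uniform law, whose push-forward is the given law.\<close>
  also have "\<dots> = (\<integral>\<^sup>+u. indicator (A \<inter> {..T p}) (T u) * indicator {0<..<1} u \<partial>lborel)"
  proof (rule nn_integral_cong_AE)
    show "AE u in lborel. indicator A (T u) * indicator {0..p} u =
        (indicator (A \<inter> {..T p}) (T u) * indicator {0<..<1} u :: ennreal)"
      using AE_lborel_singleton[of 0] by eventually_elim (use p in \<open>auto simp: indicator_def T_le\<close>)
  qed
  also have "\<dots> = (\<integral>\<^sup>+u. indicator (A \<inter> {..T p}) (T u) \<partial>?U)"
    by (simp add: nn_integral_restrict_space)
  also have "\<dots> = emeasure (distr ?U borel T) (A \<inter> {..T p})"
    using A TU by (simp add: nn_integral_distr[symmetric])
  also have "distr ?U borel T = ?D"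
    unfolding T_eq by (rule distr_I_eq_M)
  also have "emeasure ?D (A \<inter> {..T p}) = (\<integral>\<^sup>+x. ennreal (g x) * indicator (A \<inter> {..T p}) x \<partial>lborel)"
    by (subst emeasure_density) auto
  \<comment> \<open>Vanishing of \<open>g\<close> on the negative half-line supplies the lower end 0
    of the interval.\<close>
  also have "\<dots> = (\<integral>\<^sup>+x. ennreal (g x * indicator {0..T p} x) * indicator A x \<partial>lborel)"
    using supp by (intro nn_integral_cong_AE, elim AE_mp, intro AE_I2) (auto simp: indicator_def)
  also have "\<dots> = emeasure (density lborel (\<lambda>x. ennreal (g x * indicator {0..T p} x))) A"
    by (subst emeasure_density) auto
  finally show "emeasure (distr ?V borel T) A =
      emeasure (density lborel (\<lambda>x. ennreal (g x * indicator {0..T p} x))) A" .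
qed simp

section \<open>Past mutual information under a change of variables\<close>

text \<open>Up to normalisation the truncated marginals are \<open>a x * H1 x\<close> and
  \<open>b y * H2 y\<close>. Inside the logarithm \<open>a\<close> and \<open>b\<close> cancel, and
  the three divisions by \<open>r\<close> leave one factor \<open>r\<close>; outside it,
  \<open>a\<close> and \<open>b\<close> serve as the densities of the push-forwards under
  \<open>S\<close> and \<open>T\<close>.\<close>

lemma past_mutual_information_transport:
  fixes a b :: "real \<Rightarrow> real" and f h F :: "real \<Rightarrow> real \<Rightarrow> real"
  assumes "sigma_finite_measure V" "sigma_finite_measure W"
    and [measurable]: "a \<in> borel_measurable borel" "b \<in> borel_measurable borel"
      "S \<in> borel_measurable V" "T \<in> borel_measurable W"
      "(\<lambda>(x, y). f x y) \<in> borel_measurable (borel \<Otimes>\<^sub>M borel)"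
      "(\<lambda>(x, y). h x y) \<in> borel_measurable (borel \<Otimes>\<^sub>M borel)"
    and a: "\<And>x. 0 \<le> a x" "\<And>x. x \<notin> {0..s} \<Longrightarrow> a x = 0"
    and b: "\<And>y. 0 \<le> b y" "\<And>y. y \<notin> {0..t} \<Longrightarrow> b y = 0"
    and S: "distr V borel S = density lborel (\<lambda>x. ennreal (a x))"
    and T: "distr W borel T = density lborel (\<lambda>y. ennreal (b y))"
    and eq: "AE x in lborel. AE y in lborel. x \<in> {0..s} \<longrightarrow> y \<in> {0..t} \<longrightarrow> f x y = a x * b y * h x y"
    and r: "F s t = r" "0 < r"
  shows "past_mutual_information f F s t =
    ext_integral V (\<lambda>u. ext_integral W (\<lambda>v. ereal (h (S u) (T v) / r *
      ln (r * h (S u) (T v) / ((LINT w|W. h (S u) (T w)) * (LINT z|V. h (S z) (T v)))))))"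
proof -
  interpret V: sigma_finite_measure V by fact
  interpret W: sigma_finite_measure W by fact
  \<comment> \<open>The second marginal fixes \<open>y\<close> first; the set of good pairs is
    measurable here, so the quantifiers may be exchanged.\<close>
  have eq': "AE y in lborel. AE x in lborel. x \<in> {0..s} \<longrightarrow> y \<in> {0..t} \<longrightarrow> f x y = a x * b y * h x y"
  proof (rule lborel_pair.AE_commute[THEN iffD1, OF _ eq])
    show "{z \<in> space (lborel \<Otimes>\<^sub>M lborel). fst z \<in> {0..s} \<longrightarrow> snd z \<in> {0..t} \<longrightarrow>
        f (fst z) (snd z) = a (fst z) * b (snd z) * h (fst z) (snd z)} \<in> sets (lborel \<Otimes>\<^sub>M lborel)"
      by measurable
  qed
  define H1 where "H1 x = (LINT w|W. h x (T w))" for x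
  define H2 where "H2 y = (LINT z|V. h (S z) y)" for y
  have [measurable]: "H1 \<in> borel_measurable borel" "H2 \<in> borel_measurable borel"
    unfolding H1_def H2_def by measurable
  define f1 where "f1 x = (LINT y|lebesgue_on {0..t}. f x y)" for x
  define f2 where "f2 y = (LINT x|lebesgue_on {0..s}. f x y)" for y
  have f1: "AE x in lborel. x \<in> {0..s} \<longrightarrow> f1 x = a x * H1 x"
    using eq
  proof eventually_elim
    case (elim x)
    show ?case
    proof
      assume "x \<in> {0..s}"
      with elim have "AE y in lborel. y \<in> {0..t} \<longrightarrow> f x y = b y * (a x * h x y)"
        by (auto elim!: AE_mp)
      then have "f1 x = (LINT w|W. a x * h x (T w))"
        unfolding f1_def using b T by (intro integral_lebesgue_on_transport[where a=b]) auto
      then show "f1 x = a x * H1 x"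
        by (simp add: H1_def)
    qed
  qed
  have f2: "AE y in lborel. y \<in> {0..t} \<longrightarrow> f2 y = b y * H2 y"
    using eq'
  proof eventually_elim
    case (elim y)
    show ?case
    proof
      assume "y \<in> {0..t}"
      with elim have "AE x in lborel. x \<in> {0..s} \<longrightarrow> f x y = a x * (b y * h x y)"
        by (auto elim!: AE_mp)
      then have "f2 y = (LINT z|V. b y * h (S z) y)"
        unfolding f2_def using a S by (intro integral_lebesgue_on_transport[where a=a]) auto
      then show "f2 y = b y * H2 y"
        by (simp add: H2_def)
    qed
  qed
  define \<Phi> where "\<Phi> x y = h x y / r * ln (r * h x y / (H1 x * H2 y))" for x y
  have [measurable]: "(\<lambda>(x, y). \<Phi> x y) \<in> borel_measurable (borel \<Otimes>\<^sub>M borel)"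
    unfolding \<Phi>_def by measurable
  define G where "G x = ext_integral W (\<lambda>v. ereal (\<Phi> x (T v)))" for x
  have [measurable]: "G \<in> borel_measurable borel"
    unfolding G_def by (intro borel_measurable_ext_integral) (unfold_locales, measurable)
  define g where "g x y = past_density f F s t x y *
         ln (past_density f F s t x y / (past_density_fst f F s t x * past_density_snd f F s t y))" for x y
  have "AE x in lborel. x \<in> {0..s} \<longrightarrow>
      ext_integral (lebesgue_on {0..t}) (\<lambda>y. ereal (g x y)) = ereal (a x) * G x"
    using f1 eq
  proof eventually_elim
    case (elim x)
    show ?case
    proof
      assume x: "x \<in> {0..s}"
      have "AE y in lborel. y \<in> {0..t} \<longrightarrow> ereal (g x y) = ereal (b y) * ereal (a x * \<Phi> x y)"
        using elim(2) f2
      proof eventually_elim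
        case (elim y)
        show ?case
        proof
          assume y: "y \<in> {0..t}"
          have *: "f x y = a x * b y * h x y" "f1 x = a x * H1 x" "f2 y = b y * H2 y"
            using elim x y \<open>x \<in> {0..s} \<longrightarrow> f1 x = a x * H1 x\<close> by auto
          have "a x * b y * h x y / r / (1 / r * (a x * H1 x) * (1 / r * (b y * H2 y))) =
              r * h x y / (H1 x * H2 y)" if "a x \<noteq> 0" "b y \<noteq> 0"
            using that r(2) by (simp add: divide_simps)
          moreover have "g x y = a x * b y * h x y / r *
              ln (a x * b y * h x y / r / (1 / r * (a x * H1 x) * (1 / r * (b y * H2 y))))"
            unfolding g_def past_density_def past_density_fst_def past_density_snd_def r(1)
              f1_def[symmetric] f2_def[symmetric] * ..
          \<comment> \<open>Where \<open>a x\<close> or \<open>b y\<close> is 0 nothing cancels, but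
            the prefactor makes both sides 0.\<close>
          ultimately have "g x y = b y * (a x * \<Phi> x y)"
            by (cases "a x = 0 \<or> b y = 0") (auto simp: \<Phi>_def simp del: times_divide_eq_left)
          then show "ereal (g x y) = ereal (b y) * ereal (a x * \<Phi> x y)"
            by simp
        qed
      qed
      then have "ext_integral (lebesgue_on {0..t}) (\<lambda>y. ereal (g x y)) =
          ext_integral W (\<lambda>v. ereal (a x * \<Phi> x (T v)))"
        using b T by (intro ext_integral_lebesgue_on_transport[where a=b]) auto
      also have "\<dots> = ext_integral W (\<lambda>v. ereal (a x) * ereal (\<Phi> x (T v)))"
        by simp
      also have "\<dots> = ereal (a x) * G x"
        unfolding G_def using a(1) by (intro ext_integral_cmult) measurable
      finally show "ext_integral (lebesgue_on {0..t}) (\<lambda>y. ereal (g x y)) = ereal (a x) * G x" .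
    qed
  qed
  from ext_integral_lebesgue_on_transport[OF _ _ _ _ a S this]
  have "ext_integral (lebesgue_on {0..s}) (\<lambda>x. ext_integral (lebesgue_on {0..t}) (\<lambda>y. ereal (g x y)))
      = ext_integral V (\<lambda>u. G (S u))"
    by simp
  then show ?thesis
    by (simp add: past_mutual_information_def g_def G_def \<Phi>_def H1_def H2_def)
qed

section \<open>Quantile substitution and the copula density\<close>

theorem proposition7:
  fixes M :: "'a measure" and X Y :: "'a \<Rightarrow> real"
    and f :: "real \<Rightarrow> real \<Rightarrow> real" and fX fY :: "real \<Rightarrow> real"
    and C c :: "real \<Rightarrow> real \<Rightarrow> real" and p q :: real
  defines "FX \<equiv> cdf (distr M borel X)" and "FY \<equiv> cdf (distr M borel Y)"
  assumes "prob_space M"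
    and "AE \<omega> in M. 0 \<le> X \<omega>" and "AE \<omega> in M. 0 \<le> Y \<omega>"
    and "\<And>x. 0 \<le> fX x" and "distributed M lborel X (\<lambda>x. ennreal (fX x))"
    and "\<And>y. 0 \<le> fY y" and "distributed M lborel Y (\<lambda>y. ennreal (fY y))"
    and "\<And>x y. 0 \<le> f x y"
    and "distributed M (lborel \<Otimes>\<^sub>M lborel) (\<lambda>\<omega>. (X \<omega>, Y \<omega>)) (\<lambda>(x, y). ennreal (f x y))"
    and "copula_of M X Y C" and "copula_density C c"
    and "AE (x, y) in lborel \<Otimes>\<^sub>M lborel. f x y = fX x * fY y * c (FX x) (FY y)"
    and "p \<in> {0<..<1}" and "q \<in> {0<..<1}" and "C p q > 0"
  shows "past_mutual_information f (joint_cdf M X Y)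
           (generalized_inverse FX p) (generalized_inverse FY q) =
         ereal (ln (C p q)) + ereal (1 / C p q) *
           ext_integral (lebesgue_on {0..p}) (\<lambda>u. ext_integral (lebesgue_on {0..q}) (\<lambda>v.
             ereal (c u v * ln (c u v /
               ((LINT w|lebesgue_on {0..q}. c u w) * (LINT z|lebesgue_on {0..p}. c z v))))))"
proof -
  interpret prob_space M by fact
  note nonneg = \<open>\<And>x. 0 \<le> fX x\<close> \<open>\<And>y. 0 \<le> fY y\<close> \<open>\<And>x y. 0 \<le> f x y\<close>
  note pq = \<open>p \<in> {0<..<1}\<close> \<open>q \<in> {0<..<1}\<close>
  note f_eq = \<open>AE (x, y) in lborel \<Otimes>\<^sub>M lborel. f x y = fX x * fY y * c (FX x) (FY y)\<close>
  note XY = \<open>distributed M (lborel \<Otimes>\<^sub>M lborel) (\<lambda>\<omega>. (X \<omega>, Y \<omega>)) (\<lambda>(x, y). ennreal (f x y))\<close>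
  note X = \<open>distributed M lborel X (\<lambda>x. ennreal (fX x))\<close>
  note Y = \<open>distributed M lborel Y (\<lambda>y. ennreal (fY y))\<close>
  have [measurable]: "X \<in> borel_measurable M" "Y \<in> borel_measurable M"
      "fX \<in> borel_measurable borel" "fY \<in> borel_measurable borel"
    using distributed_measurable[OF X] distributed_measurable[OF Y]
      distributed_real_measurable[OF _ X] distributed_real_measurable[OF _ Y] nonneg by simp_all
  have f_meas [measurable]: "(\<lambda>(x, y). f x y) \<in> borel_measurable (borel \<Otimes>\<^sub>M borel)"
    using distributed_real_measurable[of "lborel \<Otimes>\<^sub>M lborel" "\<lambda>(x, y). f x y" M "\<lambda>\<omega>. (X \<omega>, Y \<omega>)"]
      XY nonneg
    by (simp add: case_prod_beta' cong: measurable_cong_sets sets_pair_measure_cong)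
  have DX: "distr M borel X = density lborel fX" and DY: "distr M borel Y = density lborel fY"
    using distributed_distr_eq_density[OF X] distributed_distr_eq_density[OF Y]
    by (simp_all cong: distr_cong)
  have rdX: "real_distribution (density lborel fX)" and rdY: "real_distribution (density lborel fY)"
    unfolding DX[symmetric] DY[symmetric] by (auto intro!: real_distribution_distr)
  \<comment> \<open>The distribution functions count all of \<open>{..s}\<close>, whereas the past
    densities are integrated over \<open>{0..s}\<close>.\<close>
  have suppX: "AE x in lborel. x < 0 \<longrightarrow> fX x = 0" and suppY: "AE y in lborel. y < 0 \<longrightarrow> fY y = 0"
  proof -
    have "AE x in density lborel fX. 0 \<le> x"
      unfolding DX[symmetric] using \<open>AE \<omega> in M. 0 \<le> X \<omega>\<close> by (subst AE_distr_iff) auto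
    then show "AE x in lborel. x < 0 \<longrightarrow> fX x = 0"
      using nonneg(1) by (subst (asm) AE_density) (auto elim!: AE_mp simp: not_le less_le)
    have "AE y in density lborel fY. 0 \<le> y"
      unfolding DY[symmetric] using \<open>AE \<omega> in M. 0 \<le> Y \<omega>\<close> by (subst AE_distr_iff) auto
    then show "AE y in lborel. y < 0 \<longrightarrow> fY y = 0"
      using nonneg(2) by (subst (asm) AE_density) (auto elim!: AE_mp simp: not_le less_le)
  qed

  define S where "S = generalized_inverse FX"
  define T where "T = generalized_inverse FY"
  define V where "V = restrict_space lborel {0..p}"
  define W where "W = restrict_space lborel {0..q}"
  have sf: "sigma_finite_measure V" "sigma_finite_measure W"
    unfolding V_def W_def
    by (auto intro!: sigma_finite_measure_restrict_space lborel.sigma_finite_measure_axioms)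
  have S_meas [measurable]: "S \<in> borel_measurable V" and T_meas [measurable]: "T \<in> borel_measurable W"
    unfolding S_def T_def V_def W_def FX_def FY_def DX DY using rdX rdY pq
    by (auto intro!: borel_measurable_generalized_inverse)
  define a where "a x = fX x * indicator {0..S p} x" for x
  define b where "b y = fY y * indicator {0..T q} y" for y
  have [measurable]: "a \<in> borel_measurable borel" "b \<in> borel_measurable borel"
    unfolding a_def b_def by measurable
  have ab: "0 \<le> a x" "0 \<le> b x" "x \<notin> {0..S p} \<Longrightarrow> a x = 0" "x \<notin> {0..T q} \<Longrightarrow> b x = 0" for x
    using nonneg by (auto simp: a_def b_def)
  have distrS: "distr V borel S = density lborel (\<lambda>x. ennreal (a x))"
    unfolding S_def V_def a_def FX_def DX using rdX suppX pq by (intro distr_generalized_inverse) auto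
  have distrT: "distr W borel T = density lborel (\<lambda>y. ennreal (b y))"
    unfolding T_def W_def b_def FY_def DY using rdY suppY pq by (intro distr_generalized_inverse) auto
  have F_quantile: "FX (generalized_inverse FX u) = u" "FY (generalized_inverse FY u) = u"
    if "0 < u" "u < 1" for u
    unfolding FX_def FY_def DX DY using rdX rdY that
    by (auto intro!: cdf_generalized_inverse density_lborel_continuous_cdf)

  \<comment> \<open>\<open>c\<close> itself need not be Borel measurable, but along the quantile transform it agrees almost
    everywhere with the Borel function \<open>h\<close>.\<close>
  define h where "h x y = f x y / (fX x * fY y)" for x y
  have [measurable]: "(\<lambda>(x, y). h x y) \<in> borel_measurable (borel \<Otimes>\<^sub>M borel)"
    unfolding h_def by measurable
  have h: "0 \<le> h x y" for x y
    using nonneg by (simp add: h_def)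
  define k where "k u v = h (S u) (T v)" for u v
  have k_meas [measurable]: "(\<lambda>(u, v). k u v) \<in> borel_measurable (V \<Otimes>\<^sub>M W)"
    unfolding k_def by measurable

  have f_eq1: "AE x in lborel. AE y in lborel. f x y = fX x * fY y * c (FX x) (FY y)"
    using lborel_pair.AE_pair[OF f_eq] by simp
  \<comment> \<open>The good pairs are described through \<open>c\<close>, which need not be
    measurable, so the quantifiers of \<open>f_eq1\<close> cannot simply be exchanged; the product
    measure is swapped instead.\<close>
  have f_eq2: "AE y in lborel. AE x in lborel. f x y = fX x * fY y * c (FX x) (FY y)"
  proof -
    have "AE z in lborel \<Otimes>\<^sub>M lborel. case (case z of (y, x) \<Rightarrow> (x, y)) of
        (x, y) \<Rightarrow> f x y = fX x * fY y * c (FX x) (FY y)"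
      by (rule AE_distrD[OF measurable_pair_swap'])
         (subst lborel_pair.distr_pair_swap[symmetric], rule f_eq)
    from lborel_pair.AE_pair[OF this] show ?thesis
      by simp
  qed
  have AE_not_0: "AE u in V. 0 < u \<and> u < 1" "AE v in W. 0 < v \<and> v < 1"
    unfolding V_def W_def using AE_lborel_singleton[of "0::real"] pq
    by (auto simp: AE_restrict_space_iff elim!: AE_mp)
  have c_eq1: "AE u in V. AE v in W. c u v = k u v"
  proof -
    \<comment> \<open>Almost everywhere under these two measures \<open>fX x\<close> and
      \<open>fY y\<close> are nonzero, so the division defining \<open>h\<close> is genuine and
      recovers \<open>c\<close>. Pulling back along \<open>S\<close> and \<open>T\<close> then uses
      \<open>FX (S u) = u\<close> and \<open>FY (T v) = v\<close>.\<close>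
    have "AE x in distr V borel S. AE y in distr W borel T. h x y = c (FX x) (FY y)"
      unfolding distrS distrT using f_eq1
      by (auto simp: AE_density a_def b_def h_def indicator_def elim!: AE_mp)
    from AE_distrD[OF S_meas this] have "AE u in V. AE v in W. h (S u) (T v) = c (FX (S u)) (FY (T v))"
      by eventually_elim (rule AE_distrD[OF T_meas])
    then show ?thesis
      using AE_not_0(1)
    proof eventually_elim
      case (elim u)
      from elim(1) AE_not_0(2) show ?case
        by eventually_elim (use elim(2) in \<open>simp add: k_def S_def T_def F_quantile\<close>)
    qed
  qed
  have c_eq2: "AE v in W. AE u in V. c u v = k u v"
  proof -
    have "AE y in distr W borel T. AE x in distr V borel S. h x y = c (FX x) (FY y)"
      unfolding distrS distrT using f_eq2
      by (auto simp: AE_density a_def b_def h_def indicator_def elim!: AE_mp)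
    from AE_distrD[OF T_meas this] have "AE v in W. AE u in V. h (S u) (T v) = c (FX (S u)) (FY (T v))"
      by eventually_elim (rule AE_distrD[OF S_meas])
    then show ?thesis
      using AE_not_0(2)
    proof eventually_elim
      case (elim v)
      from elim(1) AE_not_0(1) show ?case
        by eventually_elim (use elim(2) in \<open>simp add: k_def S_def T_def F_quantile\<close>)
    qed
  qed

  \<comment> \<open>Where a marginal density is 0, \<open>h\<close> is 0 by the convention for
    division, and \<open>f\<close> vanishes there almost everywhere as well.\<close>
  have f_abh: "AE x in lborel. AE y in lborel. x \<in> {0..S p} \<longrightarrow> y \<in> {0..T q} \<longrightarrow> f x y = a x * b y * h x y"
    using f_eq1
  proof eventually_elim
    case (elim x)
    then show ?case
      by eventually_elim (auto simp: a_def b_def h_def)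
  qed
  have joint: "joint_cdf M X Y (S p) (T q) = C p q"
    using \<open>copula_of M X Y C\<close> pq
    by (simp add: copula_of_def S_def T_def F_quantile FX_def[symmetric] FY_def[symmetric])
  \<comment> \<open>The total mass of \<open>k\<close> is the probability of
    \<open>X \<le> S p\<close> and \<open>Y \<le> T q\<close>, the constant that normalises the past
    densities.\<close>
  have total: "(\<integral>\<^sup>+u. \<integral>\<^sup>+v. ennreal (k u v) \<partial>W \<partial>V) = ennreal (C p q)"
  proof -
    interpret V: sigma_finite_measure V by (rule sf)
    interpret W: sigma_finite_measure W by (rule sf)
    have "ennreal (C p q) = emeasure M ((\<lambda>\<omega>. (X \<omega>, Y \<omega>)) -` ({..S p} \<times> {..T q}) \<inter> space M)"
      unfolding joint[symmetric] joint_cdf_def emeasure_eq_measure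
      by (intro arg_cong[where f=ennreal] arg_cong[where f="measure M"]) auto
    also have "\<dots> = (\<integral>\<^sup>+z. (case z of (x, y) \<Rightarrow> ennreal (f x y)) * indicator ({..S p} \<times> {..T q}) z
        \<partial>(lborel \<Otimes>\<^sub>M lborel))"
      by (intro distributed_emeasure[OF XY]) auto
    also have "\<dots> = (\<integral>\<^sup>+x. \<integral>\<^sup>+y. ennreal (f x y) * indicator ({..S p} \<times> {..T q}) (x, y) \<partial>lborel \<partial>lborel)"
      by (subst lborel.nn_integral_fst[symmetric]) auto
    also have "\<dots> = (\<integral>\<^sup>+x. \<integral>\<^sup>+y. ennreal (a x) * (ennreal (b y) * ennreal (h x y)) \<partial>lborel \<partial>lborel)"
    proof (rule nn_integral_cong_AE)
      show "AE x in lborel. (\<integral>\<^sup>+y. ennreal (f x y) * indicator ({..S p} \<times> {..T q}) (x, y) \<partial>lborel) =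
          (\<integral>\<^sup>+y. ennreal (a x) * (ennreal (b y) * ennreal (h x y)) \<partial>lborel)"
        using f_eq1 suppX
      proof eventually_elim
        case (elim x)
        \<comment> \<open>For negative \<open>x\<close> or \<open>y\<close> the marginal density,
          and with it \<open>f\<close>, vanishes almost everywhere, so the quadrant shrinks to the
          rectangle starting at 0.\<close>
        from elim(1) suppY
        have "AE y in lborel. ennreal (f x y) * indicator ({..S p} \<times> {..T q}) (x, y) =
            ennreal (a x) * (ennreal (b y) * ennreal (h x y))"
        proof eventually_elim
          case (elim y)
          then have "f x y * indicator ({..S p} \<times> {..T q}) (x, y) = a x * (b y * h x y)"
            using \<open>x < 0 \<longrightarrow> fX x = 0\<close> by (auto simp: a_def b_def h_def indicator_def)
          then have "ennreal (f x y * indicator ({..S p} \<times> {..T q}) (x, y)) = ennreal (a x * (b y * h x y))"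
            by simp
          then show ?case
            using ab h nonneg by (simp add: ennreal_mult ennreal_indicator)
        qed
        then show ?case
          by (rule nn_integral_cong_AE)
      qed
    qed
    also have "\<dots> = (\<integral>\<^sup>+x. ennreal (a x) * (\<integral>\<^sup>+y. ennreal (b y) * ennreal (h x y) \<partial>lborel) \<partial>lborel)"
      by (simp add: nn_integral_cmult)
    also have "\<dots> = (\<integral>\<^sup>+x. \<integral>\<^sup>+y. ennreal (h x y) \<partial>density lborel b \<partial>density lborel a)"
      by (simp add: nn_integral_density)
    also have "\<dots> = (\<integral>\<^sup>+u. \<integral>\<^sup>+v. ennreal (k u v) \<partial>W \<partial>V)"
      unfolding distrS[symmetric] distrT[symmetric] k_def by (simp add: nn_integral_distr)
    finally show ?thesis ..
  qed

  define K1 where "K1 u = (LINT w|W. k u w)" for u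
  define K2 where "K2 v = (LINT z|V. k z v)" for v
  \<comment> \<open>The section \<open>c u\<close> is known only to equal the Borel function
    \<open>k u\<close> almost everywhere; completeness of Lebesgue measure makes the integrals
    agree.\<close>
  have c1: "AE u in V. (LINT w|lebesgue_on {0..q}. c u w) = K1 u"
    using c_eq1 AE_space
  proof eventually_elim
    case (elim u)
    note [measurable] = elim(2)
    show ?case
      using elim(1) unfolding K1_def W_def
      by (intro integral_lebesgue_on_AE_eq) (simp_all add: W_def[symmetric])
  qed
  have c2: "AE v in W. (LINT z|lebesgue_on {0..p}. c z v) = K2 v"
    using c_eq2 AE_space
  proof eventually_elim
    case (elim v)
    note [measurable] = elim(2)
    show ?case
      using elim(1) unfolding K2_def V_def
      by (intro integral_lebesgue_on_AE_eq) (simp_all add: V_def[symmetric] k_def)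
  qed
  have rhs: "ext_integral (lebesgue_on {0..p}) (\<lambda>u. ext_integral (lebesgue_on {0..q}) (\<lambda>v.
      ereal (c u v * ln (c u v / ((LINT w|lebesgue_on {0..q}. c u w) * (LINT z|lebesgue_on {0..p}. c z v)))))) =
    ext_integral V (\<lambda>u. ext_integral W (\<lambda>v. ereal (k u v * ln (k u v / (K1 u * K2 v)))))"
    unfolding ext_integral_lebesgue_on[OF atLeastAtMost_borel] V_def[symmetric] W_def[symmetric]
  proof (rule ext_integral_cong_AE)
    show "AE u in V. ext_integral W (\<lambda>v. ereal (c u v * ln (c u v /
          ((LINT w|lebesgue_on {0..q}. c u w) * (LINT z|lebesgue_on {0..p}. c z v))))) =
        ext_integral W (\<lambda>v. ereal (k u v * ln (k u v / (K1 u * K2 v))))"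
      using c_eq1 c1
    proof eventually_elim
      case (elim u)
      from elim(1) c2
      have "AE v in W. ereal (c u v * ln (c u v /
            ((LINT w|lebesgue_on {0..q}. c u w) * (LINT z|lebesgue_on {0..p}. c z v)))) =
          ereal (k u v * ln (k u v / (K1 u * K2 v)))"
        by eventually_elim (simp add: elim(2))
      then show ?case
        by (rule ext_integral_cong_AE)
    qed
  qed
  have "past_mutual_information f (joint_cdf M X Y) (S p) (T q) =
      ext_integral V (\<lambda>u. ext_integral W (\<lambda>v.
        ereal (k u v / C p q * ln (C p q * k u v / (K1 u * K2 v)))))"
    unfolding k_def K1_def K2_def using sf ab distrS distrT f_abh joint \<open>C p q > 0\<close>
    by (intro past_mutual_information_transport[where a=a and b=b]) auto
  also have "\<dots> = ereal (ln (C p q)) + ereal (1 / C p q) *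
      ext_integral V (\<lambda>u. ext_integral W (\<lambda>v. ereal (k u v * ln (k u v / (K1 u * K2 v)))))"
    unfolding K1_def K2_def using sf total h \<open>C p q > 0\<close>
    by (intro ext_integral_information_rescale) (auto simp: k_def)
  finally show ?thesis
    unfolding rhs S_def T_def .
qed

end
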